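(* For every integer $n\ge 1$, the $(n-1)$st reduced Betti number of the Stirling complex $\operatorname{St}(2n)$ is $n!$.
   Context: For a positive integer $m$, the Stirling complex $\operatorname{St}(m)$ is the simplicial complex whose vertices are the squares $(i,j)$ with $1\le i\le j\le m$ ($i$ is the column, $j$ the row) and whose faces are the non-attacking rook placements, i.e. the sets of squares no two of which lie in the same row or in the same column. The $k$th reduced Betti number is the rank of the $k$th reduced homology group. *)

theory Defs
  imports "HOL-Algebra.Free_Abelian_Groups" "HOL-Library.Extended_Nat"
begin

text \<open>
  An abstract simplicial complex is given by its set of faces, including the empty face, which has
  dimension \<open>-1\<close>. The relation \<open>r\<close> below is a strict linear order on the vertices. It is used only
  to choose signs: \<open>{v\<^sub>0 < \<dots> < v\<^sub>k}\<close> is identified with the oriented simplex \<open>[v\<^sub>0, \<dots>, v\<^sub>k]\<close>.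
\<close>

definition simplices :: "'a set set \<Rightarrow> int \<Rightarrow> 'a set set" where
  "simplices K k = {\<sigma> \<in> K. finite \<sigma> \<and> int (card \<sigma>) = k + 1}"

definition simplicial_chain_group :: "'a set set \<Rightarrow> int \<Rightarrow> ('a set \<Rightarrow>\<^sub>0 int) monoid" where
  "simplicial_chain_group K k = free_Abelian_group (simplices K k)"

text \<open>
  If \<open>v = v\<^sub>i\<close> in \<open>\<sigma> = {v\<^sub>0 < \<dots> < v\<^sub>k}\<close>, then \<open>i\<close> is the number of vertices of \<open>\<sigma>\<close> below \<open>v\<close>. For a
  single vertex the formula gives the augmentation \<open>\<partial>{v} = {}\<close>, so the homology is reduced.
\<close>

definition face_boundary :: "('a \<times> 'a) set \<Rightarrow> 'a set \<Rightarrow> ('a set \<Rightarrow>\<^sub>0 int)" where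
  "face_boundary r \<sigma> =
     (\<Sum>v\<in>\<sigma>. frag_cmul ((- 1) ^ card {u \<in> \<sigma>. (u, v) \<in> r}) (frag_of (\<sigma> - {v})))"

definition simplicial_boundary ::
    "('a \<times> 'a) set \<Rightarrow> ('a set \<Rightarrow>\<^sub>0 int) \<Rightarrow> ('a set \<Rightarrow>\<^sub>0 int)" where
  "simplicial_boundary r = frag_extend (face_boundary r)"

definition simplicial_cycles ::
    "('a \<times> 'a) set \<Rightarrow> 'a set set \<Rightarrow> int \<Rightarrow> ('a set \<Rightarrow>\<^sub>0 int) set" where
  "simplicial_cycles r K k =
     {c \<in> carrier (simplicial_chain_group K k). simplicial_boundary r c = 0}"

definition simplicial_boundaries ::
    "('a \<times> 'a) set \<Rightarrow> 'a set set \<Rightarrow> int \<Rightarrow> ('a set \<Rightarrow>\<^sub>0 int) set" where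
  "simplicial_boundaries r K k =
     simplicial_boundary r ` carrier (simplicial_chain_group K (k + 1))"

definition reduced_simplicial_homology_group ::
    "('a \<times> 'a) set \<Rightarrow> 'a set set \<Rightarrow> int \<Rightarrow> ('a set \<Rightarrow>\<^sub>0 int) set monoid" where
  "reduced_simplicial_homology_group r K k =
     subgroup_generated (simplicial_chain_group K k) (simplicial_cycles r K k)
       Mod simplicial_boundaries r K k"

text \<open>
  The rank of a (multiplicatively written) abelian group is the largest size of a linearly
  independent subset over the integers, with value \<open>\<infinity>\<close> if the sizes are unbounded.
\<close>

definition int_independent :: "('a, 'b) monoid_scheme \<Rightarrow> 'a set \<Rightarrow> bool" where
  "int_independent G B \<longleftrightarrow> finite B \<and> B \<subseteq> carrier G \<and>
     (\<forall>m :: 'a \<Rightarrow> int. finprod G (\<lambda>b. b [^]\<^bsub>G\<^esub> m b) B = \<one>\<^bsub>G\<^esub> \<longrightarrow> (\<forall>b\<in>B. m b = 0))"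

definition abelian_rank :: "('a, 'b) monoid_scheme \<Rightarrow> enat" where
  "abelian_rank G = Sup {enat (card B) | B. int_independent G B}"

definition reduced_betti :: "('a \<times> 'a) set \<Rightarrow> 'a set set \<Rightarrow> int \<Rightarrow> enat" where
  "reduced_betti r K k = abelian_rank (reduced_simplicial_homology_group r K k)"

definition stirling_squares :: "nat \<Rightarrow> (nat \<times> nat) set" where
  "stirling_squares m = {(i, j). 1 \<le> i \<and> i \<le> j \<and> j \<le> m}"

definition stirling_complex :: "nat \<Rightarrow> (nat \<times> nat) set set" where
  "stirling_complex m =
     {\<sigma>. \<sigma> \<subseteq> stirling_squares m \<and> pairwise (\<lambda>s t. fst s \<noteq> fst t \<and> snd s \<noteq> snd t) \<sigma>}"

abbreviation square_order :: "((nat \<times> nat) \<times> (nat \<times> nat)) set" where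
  "square_order \<equiv> less_than <*lex*> less_than"

end

theory Submission
  imports Defs "HOL-Combinatorics.Permutations"
begin

text \<open>
  The faces with \<open>n\<close> rooks in the columns \<open>1, \<dots>, n\<close> and the rows \<open>n + 1, \<dots>, 2n\<close> are facets of
  \<open>St(2n)\<close>: every square that remains lies in a column above \<open>n\<close> and a row at most \<open>n\<close>. There are
  \<open>n!\<close> of them, and they have dimension \<open>n - 1\<close>. The complex that remains when these facets are
  removed has no homology in dimensions up to \<open>n - 1\<close>. Therefore the boundary of each removed
  facet is filled in the rest, restriction of a cycle to the removed facets is onto, and its kernel
  consists of the boundaries; hence the homology in dimension \<open>n - 1\<close> is free on these facets.

  The vanishing is shown by induction, removing from the first column \<open>a\<close> all rooks except the one in
  the smallest row \<open>b \<ge> a\<close>, and then from row \<open>b\<close> all rooks except \<open>(a, b)\<close>. What is left is a cone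
  with apex \<open>(a, b)\<close>, and the link of every rook that was removed is again a complex of the same kind.
\<close>

section \<open>Cones and boundaries\<close>

text \<open>The count also makes sense for \<open>v\<close> outside \<sigma>, where it is the
  position that \<open>v\<close> takes once inserted. One sign thus serves for deleting and for
  inserting a vertex.\<close>

definition vertex_sign :: "('a \<times> 'a) set \<Rightarrow> 'a \<Rightarrow> 'a set \<Rightarrow> int" where
  "vertex_sign r v \<sigma> = (- 1) ^ card {u \<in> \<sigma>. (u, v) \<in> r}"

text \<open>The summand of the boundary that deletes \<open>v\<close>. On chains it reads off, up to
  sign, the part in the link of \<open>v\<close>.\<close>

definition drop_vertex :: "('a \<times> 'a) set \<Rightarrow> 'a \<Rightarrow> ('a set \<Rightarrow>\<^sub>0 int) \<Rightarrow> ('a set \<Rightarrow>\<^sub>0 int)" where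
  "drop_vertex r v = frag_extend
     (\<lambda>\<sigma>. if v \<in> \<sigma> then frag_cmul (vertex_sign r v \<sigma>) (frag_of (\<sigma> - {v})) else 0)"

text \<open>The join with the point \<open>v\<close>. A simplex that already contains
  \<open>v\<close> would become degenerate, hence the value 0.\<close>

definition cone :: "('a \<times> 'a) set \<Rightarrow> 'a \<Rightarrow> ('a set \<Rightarrow>\<^sub>0 int) \<Rightarrow> ('a set \<Rightarrow>\<^sub>0 int)" where
  "cone r v = frag_extend
     (\<lambda>\<sigma>. if v \<in> \<sigma> then 0 else frag_cmul (vertex_sign r v \<sigma>) (frag_of (insert v \<sigma>)))"

lemma vertex_sign_square [simp]: "vertex_sign r v \<sigma> * vertex_sign r v \<sigma> = 1"
  by (simp add: vertex_sign_def flip: power_mult_distrib)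

lemma vertex_sign_insert:
  assumes "finite \<sigma>" "v \<notin> \<sigma>"
  shows "vertex_sign r u (insert v \<sigma>) = (if (v, u) \<in> r then -1 else 1) * vertex_sign r u \<sigma>"
proof -
  have "{x \<in> insert v \<sigma>. (x, u) \<in> r} =
      (if (v, u) \<in> r then insert v {x \<in> \<sigma>. (x, u) \<in> r} else {x \<in> \<sigma>. (x, u) \<in> r})"
    by auto
  then show ?thesis
    using assms by (simp add: vertex_sign_def)
qed

lemma vertex_sign_remove:
  assumes "finite \<sigma>" "v \<in> \<sigma>"
  shows "vertex_sign r u (\<sigma> - {v}) = (if (v, u) \<in> r then -1 else 1) * vertex_sign r u \<sigma>"
  using vertex_sign_insert[of "\<sigma> - {v}" v r u] assms by (simp add: insert_absorb)

lemma drop_vertex_of: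
  "drop_vertex r v (frag_of \<sigma>) =
     (if v \<in> \<sigma> then frag_cmul (vertex_sign r v \<sigma>) (frag_of (\<sigma> - {v})) else 0)"
  by (simp add: drop_vertex_def)

lemma cone_of:
  "cone r v (frag_of \<sigma>) =
     (if v \<in> \<sigma> then 0 else frag_cmul (vertex_sign r v \<sigma>) (frag_of (insert v \<sigma>)))"
  by (simp add: cone_def)

lemma drop_vertex_linear [simp]:
  "drop_vertex r v 0 = 0"
  "drop_vertex r v (x + y) = drop_vertex r v x + drop_vertex r v y"
  "drop_vertex r v (x - y) = drop_vertex r v x - drop_vertex r v y"
  "drop_vertex r v (- x) = - drop_vertex r v x"
  "drop_vertex r v (frag_cmul c x) = frag_cmul c (drop_vertex r v x)"
  by (simp_all add: drop_vertex_def frag_extend_add frag_extend_diff frag_extend_minus frag_extend_cmul)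

lemma cone_linear [simp]:
  "cone r v 0 = 0"
  "cone r v (x + y) = cone r v x + cone r v y"
  "cone r v (x - y) = cone r v x - cone r v y"
  "cone r v (- x) = - cone r v x"
  "cone r v (frag_cmul c x) = frag_cmul c (cone r v x)"
  by (simp_all add: cone_def frag_extend_add frag_extend_diff frag_extend_minus frag_extend_cmul)

lemma simplicial_boundary_linear [simp]:
  "simplicial_boundary r 0 = 0"
  "simplicial_boundary r (x + y) = simplicial_boundary r x + simplicial_boundary r y"
  "simplicial_boundary r (x - y) = simplicial_boundary r x - simplicial_boundary r y"
  "simplicial_boundary r (- x) = - simplicial_boundary r x"
  "simplicial_boundary r (frag_cmul c x) = frag_cmul c (simplicial_boundary r x)"
  by (simp_all add: simplicial_boundary_def frag_extend_add frag_extend_diff frag_extend_minus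
      frag_extend_cmul)

lemma drop_vertex_sum: "finite I \<Longrightarrow> drop_vertex r v (sum g I) = (\<Sum>i\<in>I. drop_vertex r v (g i))"
  by (induction I rule: finite_induct) simp_all

lemma cone_sum: "finite I \<Longrightarrow> cone r v (sum g I) = (\<Sum>i\<in>I. cone r v (g i))"
  by (induction I rule: finite_induct) simp_all

lemma simplicial_boundary_of:
  "simplicial_boundary r (frag_of \<sigma>) = (\<Sum>u\<in>\<sigma>. drop_vertex r u (frag_of \<sigma>))"
  by (simp add: simplicial_boundary_def face_boundary_def drop_vertex_of vertex_sign_def)

lemma drop_vertex_twice:
  "drop_vertex r v (drop_vertex r v (frag_of \<sigma>)) = 0"
  by (simp add: drop_vertex_of)

text \<open>
  Chains are indexed by the number \<open>e\<close> of vertices of their simplices, which is the dimension plus one.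
\<close>

definition sized_chains :: "'a set set \<Rightarrow> nat \<Rightarrow> ('a set \<Rightarrow>\<^sub>0 int) set" where
  "sized_chains K e = {c. Poly_Mapping.keys c \<subseteq> {\<sigma> \<in> K. finite \<sigma> \<and> card \<sigma> = e}}"

lemma sized_chains_linear:
  "0 \<in> sized_chains K e"
  "x \<in> sized_chains K e \<Longrightarrow> y \<in> sized_chains K e \<Longrightarrow> x + y \<in> sized_chains K e"
  "x \<in> sized_chains K e \<Longrightarrow> y \<in> sized_chains K e \<Longrightarrow> x - y \<in> sized_chains K e"
  "x \<in> sized_chains K e \<Longrightarrow> - x \<in> sized_chains K e"
  "x \<in> sized_chains K e \<Longrightarrow> frag_cmul c x \<in> sized_chains K e"
  unfolding sized_chains_def
  using keys_add[of x y] keys_diff[of x y] keys_cmul[of c x] by auto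

lemma sized_chains_sum: "(\<And>i. i \<in> I \<Longrightarrow> g i \<in> sized_chains K e) \<Longrightarrow> sum g I \<in> sized_chains K e"
  by (induction I rule: infinite_finite_induct) (simp_all add: sized_chains_linear)

lemma sized_chains_of [simp]: "frag_of \<sigma> \<in> sized_chains K e \<longleftrightarrow> \<sigma> \<in> K \<and> finite \<sigma> \<and> card \<sigma> = e"
  by (simp add: sized_chains_def)

lemma sized_chains_mono: "x \<in> sized_chains K e \<Longrightarrow> K \<subseteq> L \<Longrightarrow> x \<in> sized_chains L e"
  by (auto simp: sized_chains_def)

lemma sized_chains_frag_extend:
  assumes "x \<in> sized_chains K e"
    and "\<And>\<sigma>. \<sigma> \<in> K \<Longrightarrow> finite \<sigma> \<Longrightarrow> card \<sigma> = e \<Longrightarrow> f \<sigma> \<in> sized_chains L d"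
  shows "frag_extend f x \<in> sized_chains L d"
  unfolding frag_extend_def using assms(1)
  by (intro sized_chains_sum sized_chains_linear assms(2)) (auto simp: sized_chains_def)

lemma sized_chains_induct [consumes 1, case_names zero one diff]:
  assumes "x \<in> sized_chains K e" "P 0"
    "\<And>\<sigma>. \<sigma> \<in> K \<Longrightarrow> finite \<sigma> \<Longrightarrow> card \<sigma> = e \<Longrightarrow> P (frag_of \<sigma>)"
    "\<And>x y. P x \<Longrightarrow> P y \<Longrightarrow> P (x - y)"
  shows "P x"
  using frag_induction[of x _ P] assms unfolding sized_chains_def by blast

lemma boundary_empty: "x \<in> sized_chains K 0 \<Longrightarrow> simplicial_boundary r x = 0"
  by (induction rule: sized_chains_induct) (simp_all add: simplicial_boundary_of)

text \<open>The sign computations compare two vertices at a time, so they rest on totality and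
  irreflexivity.\<close>

locale vertex_order =
  fixes r :: "('a \<times> 'a) set"
  assumes order_total: "u \<noteq> v \<Longrightarrow> (u, v) \<in> r \<longleftrightarrow> (v, u) \<notin> r"
    and order_irrefl: "(v, v) \<notin> r"
begin

text \<open>Exactly one of \<open>u\<close>, \<open>v\<close> precedes the other, so the first
  removal changes the sign of the second in exactly one of the two orders of removal.\<close>

lemma drop_vertex_anticommute:
  assumes "finite \<sigma>" "u \<noteq> v"
  shows "drop_vertex r u (drop_vertex r v (frag_of \<sigma>)) = - drop_vertex r v (drop_vertex r u (frag_of \<sigma>))"
proof (cases "u \<in> \<sigma> \<and> v \<in> \<sigma>")
  case True
  then have "\<sigma> - {u} - {v} = \<sigma> - {v} - {u}" "u \<in> \<sigma> - {v}" "v \<in> \<sigma> - {u}"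
    using assms by auto
  then show ?thesis
    using True assms order_total[of u v]
    by (simp add: drop_vertex_of vertex_sign_remove frag_cmul_cmul ac_simps)
qed (auto simp: drop_vertex_of)

lemma drop_cone_anticommute:
  assumes "finite \<sigma>" "u \<noteq> v"
  shows "drop_vertex r u (cone r v (frag_of \<sigma>)) = - cone r v (drop_vertex r u (frag_of \<sigma>))"
proof (cases "u \<in> \<sigma> \<and> v \<notin> \<sigma>")
  case True
  then have "insert v (\<sigma> - {u}) = insert v \<sigma> - {u}" 
    using assms by auto
  then show ?thesis
    using True assms order_total[of u v]
    by (simp add: drop_vertex_of cone_of vertex_sign_remove vertex_sign_insert frag_cmul_cmul ac_simps)
qed (use assms in \<open>auto simp: drop_vertex_of cone_of\<close>)

lemma drop_cone:
  assumes "finite \<sigma>" "v \<notin> \<sigma>"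
  shows "drop_vertex r v (cone r v (frag_of \<sigma>)) = frag_of \<sigma>"
  using assms order_irrefl[of v]
  by (simp add: drop_vertex_of cone_of vertex_sign_insert frag_cmul_cmul)

lemma cone_drop:
  assumes "finite \<sigma>" "v \<in> \<sigma>"
  shows "cone r v (drop_vertex r v (frag_of \<sigma>)) = frag_of \<sigma>"
  using assms order_irrefl[of v]
  by (simp add: drop_vertex_of cone_of vertex_sign_remove frag_cmul_cmul insert_absorb)

text \<open>The boundary term that removes \<open>v\<close> dies when \<open>v\<close> is dropped
  again, and all other terms anticommute. Consequently \<open>drop_vertex\<close> sends cycles to
  cycles.\<close>

lemma drop_boundary:
  assumes "x \<in> sized_chains K e"
  shows "drop_vertex r v (simplicial_boundary r x) = - simplicial_boundary r (drop_vertex r v x)"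
  using assms
proof (induction rule: sized_chains_induct)
  case (one \<sigma>)
  show ?case
  proof (cases "v \<in> \<sigma>")
    case True
    have "drop_vertex r v (simplicial_boundary r (frag_of \<sigma>)) =
        (\<Sum>u\<in>\<sigma>. drop_vertex r v (drop_vertex r u (frag_of \<sigma>)))"
      using one by (simp add: simplicial_boundary_of drop_vertex_sum)
    also have "\<dots> = (\<Sum>u\<in>\<sigma> - {v}. drop_vertex r v (drop_vertex r u (frag_of \<sigma>)))"
      using one True by (simp add: sum.remove drop_vertex_twice)
    also have "\<dots> = (\<Sum>u\<in>\<sigma> - {v}. - drop_vertex r u (drop_vertex r v (frag_of \<sigma>)))"
      using one by (intro sum.cong refl drop_vertex_anticommute) auto
    also have "\<dots> = - frag_cmul (vertex_sign r v \<sigma>) (simplicial_boundary r (frag_of (\<sigma> - {v})))"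
      using True
      by (simp add: simplicial_boundary_of frag_cmul_sum drop_vertex_of[of r v] flip: sum_negf)
    also have "\<dots> = - simplicial_boundary r (drop_vertex r v (frag_of \<sigma>))"
      using True by (simp add: drop_vertex_of)
    finally show ?thesis .
  next
    case False
    then have "drop_vertex r v (drop_vertex r u (frag_of \<sigma>)) = 0" for u
      by (simp add: drop_vertex_of)
    then show ?thesis
      using one False by (simp add: simplicial_boundary_of drop_vertex_sum) (simp add: drop_vertex_of)
  qed
qed auto

text \<open>The cone is a contracting homotopy. If \<open>v\<close> lies in \<sigma>, only the face
  without \<open>v\<close> survives coning. Otherwise the faces of the cone through \<open>v\<close>
  cancel against the cone over the boundary, and the base \<sigma> remains.\<close>

lemma cone_homotopy:
  assumes "x \<in> sized_chains K e"
  shows "simplicial_boundary r (cone r v x) + cone r v (simplicial_boundary r x) = x"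
  using assms
proof (induction rule: sized_chains_induct)
  case (one \<sigma>)
  have fin: "finite \<sigma>" by fact
  show ?case
  proof (cases "v \<in> \<sigma>")
    case True
    have "cone r v (simplicial_boundary r (frag_of \<sigma>)) = (\<Sum>u\<in>\<sigma>. cone r v (drop_vertex r u (frag_of \<sigma>)))"
      using fin by (simp add: simplicial_boundary_of cone_sum)
    also have "\<dots> = frag_of \<sigma> + (\<Sum>u\<in>\<sigma> - {v}. cone r v (drop_vertex r u (frag_of \<sigma>)))"
      using fin True by (simp add: sum.remove cone_drop)
    also have "(\<Sum>u\<in>\<sigma> - {v}. cone r v (drop_vertex r u (frag_of \<sigma>))) = 0"
      using True by (intro sum.neutral) (auto simp: drop_vertex_of cone_of)
    finally show ?thesis
      using True by (simp add: cone_of)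
  next
    case False
    have "simplicial_boundary r (cone r v (frag_of \<sigma>)) =
        (\<Sum>u\<in>insert v \<sigma>. drop_vertex r u (cone r v (frag_of \<sigma>)))"
      using fin False by (simp add: cone_of simplicial_boundary_of frag_cmul_sum frag_cmul_distrib2)
    also have "\<dots> = frag_of \<sigma> + (\<Sum>u\<in>\<sigma>. drop_vertex r u (cone r v (frag_of \<sigma>)))"
      using fin False by (simp add: drop_cone)
    also have "(\<Sum>u\<in>\<sigma>. drop_vertex r u (cone r v (frag_of \<sigma>))) = 
       (\<Sum>u\<in>\<sigma>. - cone r v (drop_vertex r u (frag_of \<sigma>)))"
      using fin False by (intro sum.cong refl drop_cone_anticommute) auto
    also have "\<dots> = - cone r v (simplicial_boundary r (frag_of \<sigma>))"
      using fin by (simp add: simplicial_boundary_of cone_sum sum_negf)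
    finally show ?thesis by simp
  qed
qed (simp_all add: algebra_simps)

lemma sized_chains_boundary:
  assumes "x \<in> sized_chains K (Suc e)" "\<And>\<sigma> v. \<sigma> \<in> K \<Longrightarrow> v \<in> \<sigma> \<Longrightarrow> \<sigma> - {v} \<in> K"
  shows "simplicial_boundary r x \<in> sized_chains K e"
  unfolding simplicial_boundary_def face_boundary_def
  using assms by (intro sized_chains_frag_extend[OF assms(1)] sized_chains_sum sized_chains_linear) auto

text \<open>The homotopy formula replaces the pairing of terms. If \<sigma> is the cone over
  \<open>t\<close>, its boundary is \<open>t\<close> minus the cone over the boundary of
  \<open>t\<close>. The latter boundary is a cycle by induction, so by the formula both parts have
  the same boundary.\<close>

lemma boundary_boundary:
  assumes "x \<in> sized_chains K e"
  shows "simplicial_boundary r (simplicial_boundary r x) = 0"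
  using assms
proof (induction e arbitrary: x K)
  case 0
  then show ?case
    by (simp add: boundary_empty)
next
  case (Suc e)
  from Suc.prems show ?case
  proof (induction rule: sized_chains_induct)
    case (one \<sigma>)
    then obtain v where v: "v \<in> \<sigma>" by fastforce
    define t where "t = drop_vertex r v (frag_of \<sigma>)"
    \<comment> \<open>\<open>K\<close> need not contain the faces of its members, so the smaller
      simplices are taken in \<open>UNIV\<close>; the induction allows any complex.\<close>
    have t: "t \<in> sized_chains UNIV e"
      using one v by (auto simp: t_def drop_vertex_of intro!: sized_chains_linear)
    have s: "frag_of \<sigma> = cone r v t"
      using one v by (simp add: t_def cone_drop)
    have b: "simplicial_boundary r (frag_of \<sigma>) = t - cone r v (simplicial_boundary r t)"
      using cone_homotopy[OF t, of v] by (simp add: s algebra_simps)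
    have tt: "simplicial_boundary r (simplicial_boundary r t) = 0"
      using Suc.IH t by blast
    show ?case
    proof (cases e)
      case 0
      then have "simplicial_boundary r t = 0"
        using t boundary_empty by blast
      then show ?thesis
        by (simp add: b)
    next
      case (Suc d)
      then have "simplicial_boundary r t \<in> sized_chains UNIV d"
        using t by (intro sized_chains_boundary) auto
      from cone_homotopy[OF this, of v] show ?thesis by (simp add: b tt)
    qed
  qed auto
qed

section \<open>Vanishing of homology in low dimensions\<close>

text \<open>Since \<open>e\<close> counts vertices, this is the vanishing of reduced homology in
  dimensions up to \<open>d - 2\<close>. The case \<open>e = 0\<close> concerns the empty face: a
  complex that has it must also have a vertex.\<close>

definition acyclic_below :: "'a set set \<Rightarrow> nat \<Rightarrow> bool" where
  "acyclic_below K d \<longleftrightarrow>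
     (\<forall>e<d. \<forall>z\<in>sized_chains K e. simplicial_boundary r z = 0 \<longrightarrow>
        (\<exists>y\<in>sized_chains K (Suc e). simplicial_boundary r y = z))"

lemma acyclic_belowD:
  assumes "acyclic_below K d" "e < d" "z \<in> sized_chains K e" "simplicial_boundary r z = 0"
  obtains y where "y \<in> sized_chains K (Suc e)" "simplicial_boundary r y = z"
  using assms unfolding acyclic_below_def by blast

lemma acyclic_below_cone:
  assumes "\<And>\<sigma>. \<sigma> \<in> K \<Longrightarrow> insert v \<sigma> \<in> K"
  shows "acyclic_below K d"
  unfolding acyclic_below_def
proof (intro allI impI ballI)
  fix e z
  assume z: "z \<in> sized_chains K e" and cyc: "simplicial_boundary r z = 0"
  have "cone r v z \<in> sized_chains K (Suc e)"
    unfolding cone_def by (intro sized_chains_frag_extend[OF z]) (auto intro!: sized_chains_linear assms)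
  moreover have "simplicial_boundary r (cone r v z) = z"
    using cone_homotopy[OF z, of v] cyc by simp
  ultimately show "\<exists>y\<in>sized_chains K (Suc e). simplicial_boundary r y = z" by blast
qed

text \<open>A Mayer-Vietoris argument for the deletion and the star of \<open>v\<close>, which meet
  in the link. The part of a cycle through \<open>v\<close> leaves in the link a cycle with one
  vertex fewer, which is why the link needs one degree less.\<close>

lemma acyclic_below_vertex:
  assumes down: "\<And>\<sigma> \<tau>. \<sigma> \<in> K \<Longrightarrow> \<tau> \<subseteq> \<sigma> \<Longrightarrow> \<tau> \<in> K"
    and del: "acyclic_below {\<sigma> \<in> K. v \<notin> \<sigma>} (Suc d)"
    and link: "acyclic_below {\<sigma>. v \<notin> \<sigma> \<and> insert v \<sigma> \<in> K} d"
  shows "acyclic_below K (Suc d)"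
  unfolding acyclic_below_def
proof (intro allI impI ballI)
  let ?D = "{\<sigma> \<in> K. v \<notin> \<sigma>}" and ?L = "{\<sigma>. v \<notin> \<sigma> \<and> insert v \<sigma> \<in> K}"
  fix e z
  assume e: "e < Suc d" and z: "z \<in> sized_chains K e" and cyc: "simplicial_boundary r z = 0"
  have LD: "?L \<subseteq> ?D"
    using down by blast
  have DK: "?D \<subseteq> K" by blast
  define p where "p = drop_vertex r v z"
  \<comment> \<open>Coning restores the simplices through \<open>v\<close>, so the difference is the
    part of \<open>z\<close> that avoids \<open>v\<close>.\<close>
  have zL: "z - cone r v p \<in> sized_chains ?D e"
    using z unfolding p_def
  proof (induction rule: sized_chains_induct)
    case (one \<sigma>)
    then show ?case
      by (cases "v \<in> \<sigma>") (simp_all add: cone_drop sized_chains_linear, simp add: drop_vertex_of)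
  next
    case (diff x y)
    then show ?case
      using sized_chains_linear(3)[OF diff] by (simp add: algebra_simps)
  qed (simp add: sized_chains_linear)
  obtain y where y: "y \<in> sized_chains ?L e" "simplicial_boundary r y = p"
  proof (cases e)
    case 0
    have "p = 0"
      using z unfolding p_def 0
      by (induction rule: sized_chains_induct) (auto simp: drop_vertex_of)
    then show ?thesis
      using that[of 0] by (simp add: sized_chains_linear)
  next
    case (Suc e')
    have "p \<in> sized_chains ?L e'"
      unfolding p_def drop_vertex_def
      by (intro sized_chains_frag_extend[OF z]) (auto simp: Suc insert_absorb intro!: sized_chains_linear)
    moreover have "simplicial_boundary r p = 0"
      using drop_boundary[OF z, of v] cyc by (simp add: p_def)
    moreover have "e' < d" 
      using e Suc by simp
    ultimately obtain y where "y \<in> sized_chains ?L (Suc e')" "simplicial_boundary r y = p"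
      using acyclic_belowD[OF link, of e' p] by blast
    then show ?thesis
      using that Suc by simp
  qed
  \<comment> \<open>Adding the boundary of \<open>c\<close> exchanges the part
    \<open>cone r v p\<close> of \<open>z\<close> for the chain \<open>y\<close> of the link; this
    moves the cycle into the deletion.\<close>
  define c where "c = cone r v y"
  have c: "c \<in> sized_chains K (Suc e)"
    unfolding c_def cone_def by (intro sized_chains_frag_extend[OF y(1)]) (auto intro!: sized_chains_linear)
  have bc: "simplicial_boundary r c = y - cone r v p"
    using cone_homotopy[OF y(1), of v] y(2) by (simp add: c_def algebra_simps)
  have "z + simplicial_boundary r c \<in> sized_chains ?D e"
    using sized_chains_linear(2)[OF zL sized_chains_mono[OF y(1) LD]] by (simp add: bc algebra_simps)
  moreover have "simplicial_boundary r (z + simplicial_boundary r c) = 0"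
    using cyc boundary_boundary[OF c] by simp
  ultimately obtain x where x: "x \<in> sized_chains ?D (Suc e)"
      "simplicial_boundary r x = z + simplicial_boundary r c"
    using acyclic_belowD[OF del e] by blast
  have "x - c \<in> sized_chains K (Suc e)"
    using sized_chains_linear(3)[OF sized_chains_mono[OF x(1) DK] c] .
  moreover have "simplicial_boundary r (x - c) = z"
    by (simp add: x)
  ultimately show "\<exists>y\<in>sized_chains K (Suc e). simplicial_boundary r y = z" by blast
qed

text \<open>The vertices of \<open>V\<close> are deleted one by one. As no face holds two of them,
  deleting one does not alter the link of another, so only links in the original complex
  matter.\<close>

lemma acyclic_below_independent_vertices:
  assumes "finite V"
    and "\<And>\<sigma> \<tau>. \<sigma> \<in> K \<Longrightarrow> \<tau> \<subseteq> \<sigma> \<Longrightarrow> \<tau> \<in> K"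
    and "\<And>\<sigma> u v. \<sigma> \<in> K \<Longrightarrow> u \<in> V \<inter> \<sigma> \<Longrightarrow> v \<in> V \<inter> \<sigma> \<Longrightarrow> u = v"
    and "acyclic_below {\<sigma> \<in> K. V \<inter> \<sigma> = {}} (Suc d)"
    and "\<And>v. v \<in> V \<Longrightarrow> acyclic_below {\<sigma>. v \<notin> \<sigma> \<and> insert v \<sigma> \<in> K} d"
  shows "acyclic_below K (Suc d)"
  using assms
proof (induction V arbitrary: K rule: finite_induct)
  case empty
  then show ?case by simp
next
  case (insert v V)
  show ?case
  proof (rule acyclic_below_vertex)
    show "acyclic_below {\<sigma>. v \<notin> \<sigma> \<and> insert v \<sigma> \<in> K} d"
      using insert.prems by blast
    show "acyclic_below {\<sigma> \<in> K. v \<notin> \<sigma>} (Suc d)"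
    proof (rule insert.IH)
      have "{\<sigma> \<in> {\<sigma> \<in> K. v \<notin> \<sigma>}. V \<inter> \<sigma> = {}} = {\<sigma> \<in> K. insert v V \<inter> \<sigma> = {}}"
        by auto
      then show "acyclic_below {\<sigma> \<in> {\<sigma> \<in> K. v \<notin> \<sigma>}. V \<inter> \<sigma> = {}} (Suc d)"
        using insert.prems by simp
    next
      fix u assume u: "u \<in> V"
      then have "{\<sigma>. u \<notin> \<sigma> \<and> insert u \<sigma> \<in> {\<sigma> \<in> K. v \<notin> \<sigma>}} = {\<sigma>. u \<notin> \<sigma> \<and> insert u \<sigma> \<in> K}"
        using insert.prems(2)[of "insert u _" v u] insert.hyps by fastforce
      then show "acyclic_below {\<sigma>. u \<notin> \<sigma> \<and> insert u \<sigma> \<in> {\<sigma> \<in> K. v \<notin> \<sigma>}} d"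
        using insert.prems u by simp
    next
      fix \<sigma> u w assume "\<sigma> \<in> {\<sigma> \<in> K. v \<notin> \<sigma>}" "u \<in> V \<inter> \<sigma>" "w \<in> V \<inter> \<sigma>"
      then show "u = w" using insert.prems(2) by blast
    next
      fix \<sigma> \<tau> assume "\<sigma> \<in> {\<sigma> \<in> K. v \<notin> \<sigma>}" "\<tau> \<subseteq> \<sigma>"
      then show "\<tau> \<in> {\<sigma> \<in> K. v \<notin> \<sigma>}" using insert.prems(1) by blast
    qed
  qed (use insert.prems in blast)
qed

end

section \<open>Rank of the homology\<close>

text \<open>Gaussian elimination without fractions: each step clears one coordinate by
  cross-multiplying with a pivot \<open>p\<close>.\<close>

lemma integer_dependence:
  fixes a :: "'b \<Rightarrow> 'c \<Rightarrow> int"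
  assumes "finite F" "finite B" "card F < card B"
  shows "\<exists>m. (\<exists>b\<in>B. m b \<noteq> 0) \<and> (\<forall>f\<in>F. (\<Sum>b\<in>B. m b * a b f) = 0)"
  using assms
proof (induction F arbitrary: B a rule: finite_induct)
  case empty
  then obtain b where "b \<in> B"
    by fastforce
  then show ?case
    by (intro exI[of _ "\<lambda>_. 1"]) auto
next
  case (insert f F)
  show ?case
  proof (cases "\<forall>b\<in>B. a b f = 0")
    case True
    have "card F < card B"
      using insert by simp
    then obtain m where "\<exists>b\<in>B. m b \<noteq> 0" "\<forall>f\<in>F. (\<Sum>b\<in>B. m b * a b f) = 0"
      using insert.IH[of B a] insert.prems by blast
    then show ?thesis
      using True by (intro exI[of _ m]) auto
  next
    case False
    then obtain p where p: "p \<in> B" "a p f \<noteq> 0"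
      by blast
    have "card F < card (B - {p})" "finite (B - {p})"
      using insert p by simp_all
    then obtain m where m: "\<exists>b\<in>B - {p}. m b \<noteq> 0"
      "\<And>g. g \<in> F \<Longrightarrow> (\<Sum>b\<in>B - {p}. m b * (a p f * a b g - a b f * a p g)) = 0"
      using insert.IH[of "B - {p}" "\<lambda>b g. a p f * a b g - a b f * a p g"] by blast
    \<comment> \<open>Scaling by the nonzero pivot entry keeps the relation nontrivial, and the
      coefficient of \<open>p\<close> is the one that makes coordinate \<open>f\<close>
      cancel.\<close>
    define m' where "m' b = (if b = p then - (\<Sum>b\<in>B - {p}. m b * a b f) else a p f * m b)" for b
    have sum_m': "(\<Sum>b\<in>B. m' b * a b g) =
        (\<Sum>b\<in>B - {p}. m b * (a p f * a b g - a b f * a p g))" for g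
    proof -
      have "(\<Sum>b\<in>B. m' b * a b g) = m' p * a p g + (\<Sum>b\<in>B - {p}. m' b * a b g)"
        using insert.prems p by (simp add: sum.remove)
      also have "(\<Sum>b\<in>B - {p}. m' b * a b g) = (\<Sum>b\<in>B - {p}. a p f * m b * a b g)"
        by (intro sum.cong) (auto simp: m'_def)
      also have "m' p = - (\<Sum>b\<in>B - {p}. m b * a b f)"
        by (simp add: m'_def)
      finally show ?thesis
        by (simp add: sum_distrib_left sum_distrib_right sum_subtractf algebra_simps)
    qed
    have "(\<Sum>b\<in>B. m' b * a b g) = 0" if "g \<in> insert f F" for g
      using that m(2)[of g] unfolding sum_m' by (auto simp: mult.commute)
    moreover have "\<exists>b\<in>B. m' b \<noteq> 0"
      using m(1) p by (auto simp: m'_def)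
    ultimately show ?thesis by blast
  qed
qed

lemma finprod_free_Abelian_group:
  assumes "finite B" "\<And>b. b \<in> B \<Longrightarrow> Poly_Mapping.keys (g b) \<subseteq> S"
  shows "finprod (free_Abelian_group S) g B = sum g B"
  using assms
proof (induction B rule: finite_induct)
  case empty
  then show ?case
    by (simp add: comm_monoid.finprod_empty comm_group.axioms(1) abelian_free_Abelian_group)
next
  case (insert b B)
  then show ?case
    by (subst comm_monoid.finprod_insert)
      (auto simp: comm_group.axioms(1) abelian_free_Abelian_group)
qed

lemma int_independent_free_Abelian_group_iff:
  "int_independent (free_Abelian_group S) B \<longleftrightarrow>
     finite B \<and> (\<forall>b\<in>B. Poly_Mapping.keys b \<subseteq> S) \<and>
     (\<forall>m. (\<Sum>b\<in>B. frag_cmul (m b) b) = 0 \<longrightarrow> (\<forall>b\<in>B. m b = 0))"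
proof -
  have "finprod (free_Abelian_group S) (\<lambda>b. b [^]\<^bsub>free_Abelian_group S\<^esub> m b) B =
      (\<Sum>b\<in>B. frag_cmul (m b) b)"
    if "finite B" "\<forall>b\<in>B. Poly_Mapping.keys b \<subseteq> S" for m :: "_ \<Rightarrow> int"
  proof -
    have "Poly_Mapping.keys (b [^]\<^bsub>free_Abelian_group S\<^esub> m b) \<subseteq> S" if "b \<in> B" for b
      using \<open>\<forall>b\<in>B. _\<close> that keys_cmul[of "m b" b] by (simp add: subset_trans)
    then have "finprod (free_Abelian_group S) (\<lambda>b. b [^]\<^bsub>free_Abelian_group S\<^esub> m b) B =
        (\<Sum>b\<in>B. b [^]\<^bsub>free_Abelian_group S\<^esub> m b)"
      using that by (intro finprod_free_Abelian_group)
    then show ?thesis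
      using that by simp
  qed
  then show ?thesis
    unfolding int_independent_def by (auto simp: subset_iff)
qed

lemma lookup_sum_frag_cmul:
  "Poly_Mapping.lookup (\<Sum>b\<in>B. frag_cmul (m b) (g b)) x = (\<Sum>b\<in>B. m b * Poly_Mapping.lookup (g b) x)"
  by (induction B rule: infinite_finite_induct) (simp_all add: lookup_add)

text \<open>The generators give the lower bound. A larger family has a nontrivial relation in all
  coordinates of \<open>S\<close> at once, and no other coordinate occurs.\<close>

lemma abelian_rank_free_Abelian_group:
  assumes "finite S"
  shows "abelian_rank (free_Abelian_group S) = enat (card S)"
  unfolding abelian_rank_def
proof (rule Sup_eqI)
  fix y assume "y \<in> {enat (card B) | B. int_independent (free_Abelian_group S) B}"
  then obtain B where y: "y = enat (card B)" and B: "int_independent (free_Abelian_group S) B"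
    by blast
  have "card B \<le> card S"
  proof (rule ccontr)
    assume "\<not> card B \<le> card S"
    then obtain m where m: "\<exists>b\<in>B. m b \<noteq> 0"
      "\<forall>s\<in>S. (\<Sum>b\<in>B. m b * Poly_Mapping.lookup b s) = 0"
      using integer_dependence[of S B Poly_Mapping.lookup] assms B
      by (auto simp: int_independent_def not_le)
    have "(\<Sum>b\<in>B. frag_cmul (m b) b) = 0"
    proof (rule poly_mapping_eqI)
      fix s
      show "Poly_Mapping.lookup (\<Sum>b\<in>B. frag_cmul (m b) b) s = Poly_Mapping.lookup 0 s"
      proof (cases "s \<in> S")
        case True
        then show ?thesis
          using m(2) by (simp add: lookup_sum_frag_cmul)
      next
        case False
        then have "Poly_Mapping.lookup b s = 0" if "b \<in> B" for b
          using B that by (meson in_keys_iff int_independent_free_Abelian_group_iff subsetD)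
        then show ?thesis
          by (simp add: lookup_sum_frag_cmul)
      qed
    qed
    then show False
      using B m(1) by (auto simp: int_independent_free_Abelian_group_iff)
  qed
  then show "y \<le> enat (card S)"
    by (simp add: y)
next
  fix y assume y: "\<And>z. z \<in> {enat (card B) | B. int_independent (free_Abelian_group S) B} \<Longrightarrow> z \<le> y"
  have inj: "inj_on frag_of S"
    by (simp add: inj_on_def frag_of_eq)
  have "int_independent (free_Abelian_group S) (frag_of ` S)"
    unfolding int_independent_free_Abelian_group_iff
  proof (intro conjI allI impI)
    fix m :: "('a \<Rightarrow>\<^sub>0 int) \<Rightarrow> int"
    assume *: "(\<Sum>b\<in>frag_of ` S. frag_cmul (m b) b) = 0"
    have "m (frag_of s) = 0" if "s \<in> S" for s
    proof -
      have "0 = Poly_Mapping.lookup (\<Sum>b\<in>frag_of ` S. frag_cmul (m b) b) s"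
        by (simp add: *)
      also have "\<dots> = (\<Sum>t\<in>S. m (frag_of t) * Poly_Mapping.lookup (frag_of t) s)"
        by (simp add: lookup_sum_frag_cmul sum.reindex[OF inj])
      also have "\<dots> = (\<Sum>t\<in>S. if t = s then m (frag_of s) else 0)"
        by (intro sum.cong) (auto simp: lookup_single when_def)
      also have "\<dots> = m (frag_of s)"
        using assms that by simp
      finally show ?thesis by simp
    qed
    then show "\<forall>b\<in>frag_of ` S. m b = 0" by blast
  qed (use assms in auto)
  then have "enat (card (frag_of ` S)) \<le> y"
    using y by blast
  then show "enat (card S) \<le> y"
    by (simp add: card_image[OF inj])
qed

section \<open>Invariance of the rank under isomorphism\<close>

lemma hom_finprod:
  assumes "comm_group G" "comm_group H" "h \<in> hom G H" "finite B" "g \<in> B \<rightarrow> carrier G"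
  shows "h (finprod G g B) = finprod H (h \<circ> g) B"
proof -
  interpret G: comm_group G by fact
  interpret H: comm_group H by fact
  show ?thesis
    using assms(4,5)
  proof (induction B rule: finite_induct)
    case empty
    then show ?case
      using hom_one[OF assms(3)] by simp
  next
    case (insert b B)
    then have "h (g b) \<in> carrier H" "(\<lambda>a. h (g a)) \<in> B \<rightarrow> carrier H"
      using hom_in_carrier[OF assms(3)] by (auto simp: Pi_iff)
    then show ?case
      using insert by (simp add: hom_mult[OF assms(3)])
  qed
qed

text \<open>By injectivity, a relation among the images pulls back to a relation with the same
  exponents.\<close>

lemma int_independent_iso:
  assumes "comm_group G" "comm_group H" "h \<in> iso G H" "int_independent G B"
  shows "int_independent H (h ` B)" "card (h ` B) = card B"
proof -
  interpret G: comm_group G by fact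
  interpret H: comm_group H by fact
  have hom: "h \<in> hom G H" and inj: "inj_on h (carrier G)"
    using assms(3) by (auto simp: iso_def bij_betw_def)
  interpret h: group_hom G H h
    by unfold_locales (rule hom)
  have B: "finite B" "B \<subseteq> carrier G"
    using assms(4) by (auto simp: int_independent_def)
  have injB: "inj_on h B"
    using inj B(2) by (rule inj_on_subset)
  then show "card (h ` B) = card B"
    by (rule card_image)
  show "int_independent H (h ` B)"
    unfolding int_independent_def
  proof (intro conjI allI impI)
    fix m :: "_ \<Rightarrow> int"
    assume *: "finprod H (\<lambda>b. b [^]\<^bsub>H\<^esub> m b) (h ` B) = \<one>\<^bsub>H\<^esub>"
    let ?g = "\<lambda>b. b [^]\<^bsub>G\<^esub> m (h b)"
    have g: "?g \<in> B \<rightarrow> carrier G"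
      using B by auto
    have "finprod H (\<lambda>b. b [^]\<^bsub>H\<^esub> m b) (h ` B) = finprod H (\<lambda>b. h b [^]\<^bsub>H\<^esub> m (h b)) B"
      using B injB by (intro H.finprod_reindex) auto
    also have "\<dots> = finprod H (h \<circ> ?g) B"
      using B by (intro H.finprod_cong') (auto simp: h.hom_int_pow)
    also have "\<dots> = h (finprod G ?g B)"
      using hom_finprod[OF assms(1,2) hom B(1) g] by simp
    finally have "h (finprod G ?g B) = h \<one>\<^bsub>G\<^esub>"
      using * by simp
    then have "finprod G ?g B = \<one>\<^bsub>G\<^esub>"
      using inj_onD[OF inj] G.finprod_closed[OF g] by blast
    then show "\<forall>b\<in>h ` B. m b = 0"
      using assms(4) unfolding int_independent_def by auto
  qed (use B hom_in_carrier[OF hom] in auto)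
qed

lemma abelian_rank_iso:
  assumes "comm_group G" "comm_group H" "h \<in> iso G H"
  shows "abelian_rank G = abelian_rank H"
proof -
  have le: "abelian_rank G \<le> abelian_rank H" if "comm_group G" "comm_group H" "h \<in> iso G H"
    for G :: "('a, 'b) monoid_scheme" and H :: "('c, 'd) monoid_scheme" and h
    unfolding abelian_rank_def
    using int_independent_iso[OF that] by (intro Sup_subset_mono) force
  have le': "abelian_rank H \<le> abelian_rank G"
    unfolding abelian_rank_def
    using int_independent_iso[OF assms(2,1) group.iso_set_sym[OF comm_group.axioms(2)[OF assms(1)] assms(3)]]
    by (intro Sup_subset_mono) force
  show ?thesis
    using le[OF assms] le' by (rule antisym)
qed

section \<open>Homology carried by a set of facets\<close>

definition restrict_chain :: "'a set \<Rightarrow> ('a \<Rightarrow>\<^sub>0 int) \<Rightarrow> ('a \<Rightarrow>\<^sub>0 int)" where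
  "restrict_chain F = frag_extend (\<lambda>\<sigma>. if \<sigma> \<in> F then frag_of \<sigma> else 0)"

lemma lookup_restrict_chain:
  "Poly_Mapping.lookup (restrict_chain F c) \<sigma> = (if \<sigma> \<in> F then Poly_Mapping.lookup c \<sigma> else 0)"
proof -
  have "Poly_Mapping.keys c \<subseteq> UNIV" by simp
  then show ?thesis
    unfolding restrict_chain_def
  proof (induction c rule: frag_induction)
    case (one x)
    show ?case
      by (cases "x = \<sigma>") (simp_all add: lookup_single)
  next
    case (diff a b)
    then show ?case
      by (simp add: frag_extend_diff lookup_minus)
  qed simp
qed

lemma carrier_simplicial_chain_group:
  "carrier (simplicial_chain_group K (int e - 1)) = sized_chains K e"
proof -
  have "simplices K (int e - 1) = {\<sigma> \<in> K. finite \<sigma> \<and> card \<sigma> = e}"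
    by (auto simp: simplices_def)
  then show ?thesis
    by (simp add: simplicial_chain_group_def free_Abelian_group_def sized_chains_def)
qed

context vertex_order
begin

text \<open>First isomorphism theorem for the restriction of cycles to \<open>F\<close>. Acyclicity
  is used in two sizes: \<open>e\<close>, to fill the boundaries of facets, which gives
  surjectivity, and \<open>Suc e\<close>, to fill the cycles that avoid \<open>F\<close>, which
  gives the kernel.\<close>

lemma reduced_betti_eq_card_facets:
  assumes down: "\<And>\<sigma> \<tau>. \<sigma> \<in> K \<Longrightarrow> \<tau> \<subseteq> \<sigma> \<Longrightarrow> \<tau> \<in> K"
    and F: "finite F" "F \<subseteq> K" "\<And>\<sigma>. \<sigma> \<in> F \<Longrightarrow> card \<sigma> = Suc e"
    and facet: "\<And>\<sigma> \<tau>. \<sigma> \<in> F \<Longrightarrow> \<tau> \<in> K \<Longrightarrow> \<sigma> \<subseteq> \<tau> \<Longrightarrow> \<tau> = \<sigma>"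
    and acyclic: "acyclic_below (K - F) (Suc (Suc e))"
  shows "reduced_betti r K (int e) = enat (card F)"
proof -
  let ?G = "simplicial_chain_group K (int e)"
  let ?A = "free_Abelian_group F"
  define Z where "Z = simplicial_cycles r K (int e)"
  define B where "B = simplicial_boundaries r K (int e)"
  define R where "R = restrict_chain F"
  have carrier: "carrier ?G = sized_chains K (Suc e)"
    using carrier_simplicial_chain_group[of K "Suc e"] by simp
  have carrier': "carrier (simplicial_chain_group K (int e + 1)) = sized_chains K (Suc (Suc e))"
    using carrier_simplicial_chain_group[of K "Suc (Suc e)"] by (simp add: algebra_simps)
  have Z: "z \<in> Z \<longleftrightarrow> z \<in> sized_chains K (Suc e) \<and> simplicial_boundary r z = 0" for z
    by (simp add: Z_def simplicial_cycles_def carrier)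
  have B: "B = simplicial_boundary r ` sized_chains K (Suc (Suc e))"
    by (simp add: B_def simplicial_boundaries_def carrier')
  interpret G: comm_group ?G
    by (simp add: simplicial_chain_group_def abelian_free_Abelian_group)
  have mult: "x \<otimes>\<^bsub>?G\<^esub> y = x + y" and one: "\<one>\<^bsub>?G\<^esub> = 0" for x y
    by (simp_all add: simplicial_chain_group_def)
  have inv: "inv\<^bsub>?G\<^esub> x = - x" if "x \<in> carrier ?G" for x
    using that by (simp add: simplicial_chain_group_def)
  have sub: "subgroup Z ?G"
    by unfold_locales (auto simp: Z mult one carrier inv sized_chains_linear)
  let ?Z = "subgroup_generated ?G Z"
  have carrier_Z: "carrier ?Z = Z"
    using sub by (rule subgroup.carrier_subgroup_generated_subgroup)
  have comm_Z: "comm_group ?Z"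
    by (rule G.abelian_subgroup_generated) (rule G.comm_group_axioms)
  have lookup_R: "Poly_Mapping.lookup (R c) \<sigma> = (if \<sigma> \<in> F then Poly_Mapping.lookup c \<sigma> else 0)" for c \<sigma>
    unfolding R_def by (rule lookup_restrict_chain)
  have R_eq_0_iff: "R c = 0 \<longleftrightarrow> Poly_Mapping.keys c \<inter> F = {}" for c
    by (auto simp: poly_mapping_eq_iff fun_eq_iff lookup_R in_keys_iff)
  have sized_chains_diff: "c \<in> sized_chains (K - F) d \<longleftrightarrow> c \<in> sized_chains K d \<and> R c = 0" for c d
    unfolding R_eq_0_iff sized_chains_def by auto
  have R_hom: "R \<in> hom ?Z ?A"
  proof (rule homI)
    show "R x \<in> carrier ?A" for x
      by (auto simp: in_keys_iff lookup_R split: if_splits)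
    show "R (x \<otimes>\<^bsub>?Z\<^esub> y) = R x \<otimes>\<^bsub>?A\<^esub> R y" for x y
      by (simp add: mult R_def restrict_chain_def frag_extend_add)
  qed
  interpret R: group_hom ?Z ?A R
    using comm_Z R_hom by (simp add: group_hom_def group_hom_axioms_def comm_group.axioms(2))
  have kernel: "kernel ?Z ?A R = B"
  proof (intro equalityI subsetI)
    fix z assume "z \<in> kernel ?Z ?A R"
    then have "z \<in> sized_chains (K - F) (Suc e)" "simplicial_boundary r z = 0"
      by (simp_all add: kernel_def carrier_Z Z sized_chains_diff)
    then obtain y where "y \<in> sized_chains (K - F) (Suc (Suc e))" "simplicial_boundary r y = z"
      using acyclic_belowD[OF acyclic] by blast
    then show "z \<in> B"
      by (auto simp: B sized_chains_diff)
  next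
    fix z assume "z \<in> B"
    then obtain c where c: "c \<in> sized_chains K (Suc (Suc e))" "z = simplicial_boundary r c"
      by (auto simp: B)
    \<comment> \<open>A proper face of a member of \<open>K\<close> is not maximal, hence not in
      \<open>F\<close>.\<close>
    have "\<sigma> - {v} \<in> K - F" if "\<sigma> \<in> K" "v \<in> \<sigma>" for \<sigma> v
      using down[OF that(1), of "\<sigma> - {v}"] facet[of "\<sigma> - {v}" \<sigma>] that by auto
    then have "z \<in> sized_chains (K - F) (Suc e)"
      unfolding c(2) simplicial_boundary_def face_boundary_def
      by (intro sized_chains_frag_extend[OF c(1)] sized_chains_sum sized_chains_linear) auto
    moreover have "simplicial_boundary r z = 0"
      using boundary_boundary c by simp
    ultimately show "z \<in> kernel ?Z ?A R"
      by (simp add: kernel_def carrier_Z Z sized_chains_diff)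
  qed
  have image: "R ` carrier ?Z = carrier ?A"
  proof (intro equalityI subsetI)
    fix y assume "y \<in> carrier ?A"
    then have y: "Poly_Mapping.keys y \<subseteq> F"
      by simp
    \<comment> \<open>Infinite sets have \<open>card\<close> 0, so a positive cardinality gives
      finiteness.\<close>
    have "finite \<sigma>" if "\<sigma> \<in> F" for \<sigma>
      using F(3)[OF that] by (metis card.infinite nat.distinct(1))
    then have yK: "y \<in> sized_chains K (Suc e)"
      using y F by (auto simp: sized_chains_def)
    have by_K: "simplicial_boundary r y \<in> sized_chains K e"
      using yK down by (intro sized_chains_boundary) auto
    have "Poly_Mapping.keys (simplicial_boundary r y) \<inter> F = {}"
      using by_K F(3) unfolding sized_chains_def by fastforce
    then have "simplicial_boundary r y \<in> sized_chains (K - F) e"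
      using by_K by (simp add: sized_chains_diff R_eq_0_iff)
    \<comment> \<open>\<open>x\<close> has the boundary of \<open>y\<close> but no coefficient on
      \<open>F\<close>, so \<open>y - x\<close> is a cycle that restricts to
      \<open>y\<close>.\<close>
    then obtain x where x: "x \<in> sized_chains (K - F) (Suc e)" "simplicial_boundary r x = simplicial_boundary r y"
      using acyclic_belowD[OF acyclic, of e] boundary_boundary[OF yK] by auto
    have "y - x \<in> Z"
      using x yK by (simp add: Z sized_chains_diff sized_chains_linear)
    moreover have "R (y - x) = y"
    proof -
      have "R (y - x) = R y - R x"
        by (simp add: R_def restrict_chain_def frag_extend_diff)
      also have "R x = 0"
        using x by (simp add: sized_chains_diff)
      also have "R y = y"
        using y by (intro poly_mapping_eqI) (auto simp: lookup_R in_keys_iff)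
      finally show ?thesis by simp
    qed
    ultimately show "y \<in> R ` carrier ?Z"
      using carrier_Z by force
  qed (use hom_in_carrier[OF R_hom] in blast)
  have iso: "(\<lambda>X. the_elem (R ` X)) \<in> iso (?Z Mod B) ?A"
    using R.FactGroup_iso_set[OF image] by (simp add: kernel)
  have "normal B ?Z"
    using R.normal_kernel by (simp add: kernel)
  then have "comm_group (?Z Mod B)"
    using comm_Z comm_group.abelian_FactGroup normal_imp_subgroup by blast
  then have "abelian_rank (?Z Mod B) = abelian_rank ?A"
    using iso by (intro abelian_rank_iso abelian_free_Abelian_group)
  then show ?thesis
    using abelian_rank_free_Abelian_group[OF F(1)]
    by (simp add: reduced_betti_def reduced_simplicial_homology_group_def Z_def B_def)
qed

end

section \<open>Rook placements\<close>

text \<open>Columns and rows are independent parameters because links delete single lines of the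
  board. The remaining lines keep their labels, and so the condition
  \<open>i \<le> j\<close>.\<close>

definition rook_placements :: "nat set \<Rightarrow> nat set \<Rightarrow> (nat \<times> nat) set set" where
  "rook_placements C J =
     {\<sigma>. (\<forall>(i, j)\<in>\<sigma>. i \<in> C \<and> j \<in> J \<and> i \<le> j) \<and>
         pairwise (\<lambda>s t. fst s \<noteq> fst t \<and> snd s \<noteq> snd t) \<sigma>}"

lemma stirling_complex_eq: "stirling_complex m = rook_placements {1..m} {1..m}"
proof -
  have "\<sigma> \<subseteq> stirling_squares m \<longleftrightarrow> (\<forall>(i, j)\<in>\<sigma>. i \<in> {1..m} \<and> j \<in> {1..m} \<and> i \<le> j)" for \<sigma>
    unfolding stirling_squares_def by fastforce
  then show ?thesis
    unfolding stirling_complex_def rook_placements_def by simp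
qed

lemma rook_placements_downward:
  "\<sigma> \<in> rook_placements C J \<Longrightarrow> \<tau> \<subseteq> \<sigma> \<Longrightarrow> \<tau> \<in> rook_placements C J"
  unfolding rook_placements_def by (auto intro: pairwise_subset)

lemma rook_placements_squareD:
  "\<sigma> \<in> rook_placements C J \<Longrightarrow> (i, j) \<in> \<sigma> \<Longrightarrow> i \<in> C \<and> j \<in> J \<and> i \<le> j"
  unfolding rook_placements_def by blast

lemma rook_placements_columnD:
  "\<sigma> \<in> rook_placements C J \<Longrightarrow> (i, j) \<in> \<sigma> \<Longrightarrow> (i, j') \<in> \<sigma> \<Longrightarrow> j = j'"
  unfolding rook_placements_def pairwise_def by fastforce

lemma rook_placements_rowD:
  "\<sigma> \<in> rook_placements C J \<Longrightarrow> (i, j) \<in> \<sigma> \<Longrightarrow> (i', j) \<in> \<sigma> \<Longrightarrow> i = i'"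
  unfolding rook_placements_def pairwise_def by fastforce

lemma rook_placementsI:
  assumes "\<And>i j. (i, j) \<in> \<sigma> \<Longrightarrow> i \<in> C \<and> j \<in> J \<and> i \<le> j"
    and "\<And>i j j'. (i, j) \<in> \<sigma> \<Longrightarrow> (i, j') \<in> \<sigma> \<Longrightarrow> j = j'"
    and "\<And>i i' j. (i, j) \<in> \<sigma> \<Longrightarrow> (i', j) \<in> \<sigma> \<Longrightarrow> i = i'"
  shows "\<sigma> \<in> rook_placements C J"
  unfolding rook_placements_def pairwise_def
proof (intro CollectI conjI ballI impI)
  show "fst x \<noteq> fst y" "snd x \<noteq> snd y" if "x \<in> \<sigma>" "y \<in> \<sigma>" "x \<noteq> y" for x y
    using that assms(2,3) by (metis prod.collapse)+
qed (use assms(1) in auto)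

text \<open>This identifies the link of a rook with the complex of the board without its column and
  row.\<close>

lemma rook_placements_insert_iff:
  "insert (i, j) \<sigma> \<in> rook_placements C J \<and> (i, j) \<notin> \<sigma> \<longleftrightarrow>
     i \<in> C \<and> j \<in> J \<and> i \<le> j \<and> \<sigma> \<in> rook_placements (C - {i}) (J - {j})"
  (is "?L \<longleftrightarrow> ?R")
proof
  assume L: ?L
  then have "fst s \<noteq> i \<and> snd s \<noteq> j" if "s \<in> \<sigma>" for s
  proof -
    have "s \<noteq> (i, j)"
      using L that by blast
    moreover have "pairwise (\<lambda>s t. fst s \<noteq> fst t \<and> snd s \<noteq> snd t) (insert (i, j) \<sigma>)"
      using L by (simp add: rook_placements_def)
    ultimately show ?thesis
      using that by (fastforce dest: pairwiseD[of _ _ s "(i, j)"])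
  qed
  with L show ?R
    unfolding rook_placements_def by (auto simp: pairwise_insert split_beta)
next
  assume R: ?R
  then have "(i, j) \<notin> \<sigma>"
    unfolding rook_placements_def by auto
  with R show ?L
    unfolding rook_placements_def by (auto simp: pairwise_insert split_beta)
qed

lemma rook_placements_insertI:
  assumes \<sigma>: "\<sigma> \<in> rook_placements C J" and ij: "i \<in> C" "j \<in> J" "i \<le> j"
    and column: "\<And>j'. (i, j') \<in> \<sigma> \<Longrightarrow> j' = j" and row: "\<And>i'. (i', j) \<in> \<sigma> \<Longrightarrow> i' = i"
  shows "insert (i, j) \<sigma> \<in> rook_placements C J"
proof (cases "(i, j) \<in> \<sigma>")
  case True
  then show ?thesis
    using \<sigma> by (simp add: insert_absorb)
next
  case False
  have "fst s \<noteq> i \<and> snd s \<noteq> j" if "s \<in> \<sigma>" for s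
    using that False column row by (cases s) auto
  then have "\<sigma> \<in> rook_placements (C - {i}) (J - {j})"
    using \<sigma> by (auto simp: rook_placements_def split_beta)
  then show ?thesis
    using ij rook_placements_insert_iff[of i j \<sigma> C J] by simp
qed

text \<open>A row smaller than every column has no squares, so its presence makes no
  difference.\<close>

lemma rook_placements_cong:
  assumes "\<And>j. \<exists>i\<in>C. i \<le> j \<Longrightarrow> j \<in> J \<longleftrightarrow> j \<in> J'"
  shows "rook_placements C J = rook_placements C J'"
  unfolding rook_placements_def using assms by fastforce

section \<open>Vanishing for general boards\<close>

lemma vertex_order_square_order: "vertex_order square_order"
  by unfold_locales auto

interpretation squares: vertex_order square_order
  by (rule vertex_order_square_order)

text \<open>
  If the columns \<open>A\<close> and the rows \<open>B\<close> are empty in a maximal placement, then every row in \<open>B\<close> is smaller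
  than every column in \<open>A\<close>. Hence the third hypothesis forces every maximal placement to have at
  least \<open>d\<close> rooks. This alone is not enough: the two by two chessboard gives two disjoint edges. The fourth
  hypothesis excludes such boards, since it makes the sets of columns available in the rows strictly
  increasing, and it survives the induction because columns are only removed from the left.
\<close>

lemma acyclic_below_rook_placements:
  assumes "finite C" "finite J"
    and "\<And>t. d \<le> card {c \<in> C. c < t} \<or> d \<le> card {j \<in> J. t \<le> j}"
    and "\<And>i j j'. i \<in> C \<Longrightarrow> i \<le> j \<Longrightarrow> j \<in> J \<Longrightarrow> j' \<in> J \<Longrightarrow> j < j' \<Longrightarrow> \<exists>c\<in>C. j < c \<and> c \<le> j'"
  shows "squares.acyclic_below (rook_placements C J) d"
  using assms
proof (induction d arbitrary: C J)
  case 0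
  then show ?case
    by (simp add: squares.acyclic_below_def)
next
  case (Suc d)
  note finC = Suc.prems(1) and finJ = Suc.prems(2) and wide = Suc.prems(3) and gap = Suc.prems(4)
  note [simp] = finC finJ
  have "C \<noteq> {}"
  proof
    assume "C = {}"
    \<comment> \<open>A threshold above all rows leaves only the alternative about columns.\<close>
    have "{j \<in> J. Suc (Max J) \<le> j} = {}"
      by (auto simp: not_less_eq_eq)
    then show False
      using wide[of "Suc (Max J)"] unfolding \<open>C = {}\<close> by (simp only:) simp
  qed
  define a where "a = Min C"
  have a: "a \<in> C" "\<And>c. c \<in> C \<Longrightarrow> a \<le> c"
    using \<open>C \<noteq> {}\<close> by (auto simp: a_def)
  \<comment> \<open>At threshold \<open>a\<close> only the alternative about rows remains; it
    provides the row \<open>b\<close>.\<close>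
  have "{c \<in> C. c < a} = {}"
    using a by fastforce
  then have live: "Suc d \<le> card {j \<in> J. a \<le> j}"
    using wide[of a] by (simp only:) simp
  then have ne: "{j \<in> J. a \<le> j} \<noteq> {}"
    by force
  define b where "b = Min {j \<in> J. a \<le> j}"
  have b: "b \<in> J" "a \<le> b" and b_le: "\<And>j. j \<in> J \<Longrightarrow> a \<le> j \<Longrightarrow> b \<le> j"
    using Min_in[OF _ ne] by (auto simp: b_def)
  let ?K = "rook_placements C J"
  define V where "V = {(a, j) | j. j \<in> J \<and> a \<le> j \<and> j \<noteq> b}"
  define K' where "K' = {\<sigma> \<in> ?K. V \<inter> \<sigma> = {}}"
  define W where "W = {(c, b) | c. c \<in> C \<and> c \<le> b \<and> c \<noteq> a}"
  have down: "\<tau> \<in> K'" if "\<sigma> \<in> K'" "\<tau> \<subseteq> \<sigma>" for \<sigma> \<tau>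
    using that rook_placements_downward[of \<sigma> C J \<tau>] unfolding K'_def by blast
  have column_a: "j = b" if "\<sigma> \<in> K'" "(a, j) \<in> \<sigma>" for \<sigma> j
    using that rook_placements_squareD[of \<sigma> C J a j] by (auto simp: K'_def V_def)
  have "squares.acyclic_below K' (Suc d)"
  proof (rule squares.acyclic_below_independent_vertices[where V = W])
    have "W \<subseteq> C \<times> J"
      using b by (auto simp: W_def)
    then show "finite W"
      by (rule finite_subset) simp
    show "\<tau> \<in> K'" if "\<sigma> \<in> K'" "\<tau> \<subseteq> \<sigma>" for \<sigma> \<tau>
      using that by (rule down)
    show "u = v" if "\<sigma> \<in> K'" "u \<in> W \<inter> \<sigma>" "v \<in> W \<inter> \<sigma>" for \<sigma> u v
      using that rook_placements_rowD[of \<sigma> C J] unfolding K'_def W_def by auto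
    show "squares.acyclic_below {\<sigma> \<in> K'. W \<inter> \<sigma> = {}} (Suc d)"
    proof (rule squares.acyclic_below_cone[where v = "(a, b)"])
      fix \<sigma> assume \<sigma>: "\<sigma> \<in> {\<sigma> \<in> K'. W \<inter> \<sigma> = {}}"
      have "j = b" if "(a, j) \<in> \<sigma>" for j
        using that \<sigma> column_a by blast
      moreover have "c = a" if "(c, b) \<in> \<sigma>" for c
        using that \<sigma> rook_placements_squareD[of \<sigma> C J c b] by (auto simp: K'_def W_def)
      moreover have "\<sigma> \<in> rook_placements C J"
        using \<sigma> by (simp add: K'_def)
      ultimately have "insert (a, b) \<sigma> \<in> rook_placements C J"
        using a(1) b by (intro rook_placements_insertI)
      then show "insert (a, b) \<sigma> \<in> {\<sigma> \<in> K'. W \<inter> \<sigma> = {}}"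
        using \<sigma> by (auto simp: K'_def V_def W_def)
    qed
    fix v assume "v \<in> W"
    then obtain c where v: "v = (c, b)" and c: "c \<in> C" "c \<le> b" "c \<noteq> a"
      by (auto simp: W_def)
    have "a < c"
      using a c by (simp add: order_less_le)
    let ?C = "C - {c} - {a}" and ?J = "J - {b}"
    \<comment> \<open>In \<open>K'\<close> column \<open>a\<close> retains only the square
      \<open>(a, b)\<close>, which a rook in row \<open>b\<close> blocks. The link thus loses two
      columns but only one row.\<close>
    have link: "{\<sigma>. v \<notin> \<sigma> \<and> insert v \<sigma> \<in> K'} = rook_placements ?C ?J"
    proof (intro equalityI subsetI)
      fix \<sigma> assume \<sigma>: "\<sigma> \<in> {\<sigma>. v \<notin> \<sigma> \<and> insert v \<sigma> \<in> K'}"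
      then have *: "\<sigma> \<in> rook_placements (C - {c}) ?J"
        using rook_placements_insert_iff[of c b \<sigma> C J] by (simp add: K'_def v)
      moreover have "(a, j) \<notin> \<sigma>" for j
        using column_a[of "insert v \<sigma>" j] \<sigma> rook_placements_squareD[OF *, of a j] by auto
      ultimately show "\<sigma> \<in> rook_placements ?C ?J"
        unfolding rook_placements_def by fastforce
    next
      fix \<sigma> assume \<sigma>: "\<sigma> \<in> rook_placements ?C ?J"
      then have "\<sigma> \<in> rook_placements (C - {c}) ?J"
        unfolding rook_placements_def by fastforce
      then have "insert v \<sigma> \<in> ?K \<and> v \<notin> \<sigma>"
        using rook_placements_insert_iff[of c b \<sigma> C J] c b v by simp
      moreover have "(a, j) \<notin> insert v \<sigma>" for j
        using rook_placements_squareD[OF \<sigma>, of a j] c v by auto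
      ultimately show "\<sigma> \<in> {\<sigma>. v \<notin> \<sigma> \<and> insert v \<sigma> \<in> K'}"
        by (auto simp: K'_def V_def)
    qed
    show "squares.acyclic_below {\<sigma>. v \<notin> \<sigma> \<and> insert v \<sigma> \<in> K'} d"
      unfolding link
    proof (rule Suc.IH)
      fix i j j' assume *: "i \<in> ?C" "i \<le> j" "j \<in> ?J" "j' \<in> ?J" "j < j'"
      then obtain x where x: "x \<in> C" "j < x" "x \<le> j'"
        using gap[of i j j'] by auto
      \<comment> \<open>The new column satisfies \<open>x > j \<ge> b \<ge> c\<close> and
        \<open>x > a\<close>, so it is neither of the deleted ones.\<close>
      have "a \<le> j"
        using a(2)[of i] * by auto
      then have "b \<le> j"
        using b_le[of j] * by auto
      with x \<open>a \<le> j\<close> c have "x \<in> ?C"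
        by auto
      with x show "\<exists>x\<in>?C. j < x \<and> x \<le> j'"
        by blast
    next
      fix t
      show "d \<le> card {x \<in> ?C. x < t} \<or> d \<le> card {j \<in> ?J. t \<le> j}"
      proof (rule disjCI)
        assume few: "\<not> d \<le> card {j \<in> ?J. t \<le> j}"
        \<comment> \<open>Two columns are lost where \<open>d\<close> drops by one, and the gap
          hypothesis makes up for the second. Let \<open>q < p\<close> be the two largest rows in
          \<open>X\<close>. At most \<open>d\<close> rows exceed \<open>q\<close>, so at least
          \<open>Suc d\<close> columns are at most \<open>q\<close>, and one more column lies above
          \<open>q\<close> and at most at \<open>p\<close>.\<close>
        define X where "X = {j \<in> J. a \<le> j \<and> j < t}"
        have finX [simp]: "finite X"
          by (simp add: X_def)
        have bt: "b < t"
        proof (rule ccontr)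
          assume "\<not> b < t"
          then have "{j \<in> J. a \<le> j} - {b} \<subseteq> {j \<in> ?J. t \<le> j}"
            using b_le by fastforce
          from card_mono[OF _ this] have "d \<le> card {j \<in> ?J. t \<le> j}"
            using live b by simp
          with few show False by simp
        qed
        then have J_t: "{j \<in> ?J. t \<le> j} = {j \<in> J. t \<le> j}"
          by auto
        have bX: "b \<in> X"
          using b bt by (simp add: X_def)
        define p where "p = Max X"
        have p: "p \<in> X" "\<And>j. j \<in> X \<Longrightarrow> j \<le> p"
          using Max_in[OF finX] bX unfolding p_def by (blast, simp)
        \<comment> \<open>Otherwise at most \<open>d\<close> rows would be at least
          \<open>a\<close>, against \<open>live\<close>.\<close>
        have "X - {p} \<noteq> {}"
        proof
          assume "X - {p} = {}"
          then have "{j \<in> J. a \<le> j} \<subseteq> insert p {j \<in> J. t \<le> j}"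
            unfolding X_def by auto
          from card_mono[OF _ this] have "card {j \<in> J. a \<le> j} \<le> Suc (card {j \<in> J. t \<le> j})"
            using card_insert_le_m1[of "Suc (card {j \<in> J. t \<le> j})" "{j \<in> J. t \<le> j}" p] by simp
          with live few J_t show False by simp
        qed
        define q where "q = Max (X - {p})"
        have q: "q \<in> X" "q \<noteq> p" "\<And>j. j \<in> X \<Longrightarrow> j \<noteq> p \<Longrightarrow> j \<le> q"
          using Max_in[OF _ \<open>X - {p} \<noteq> {}\<close>] by (auto simp: q_def)
        have "q < p"
          using p(2)[OF q(1)] q(2) by simp
        have "{j \<in> J. Suc q \<le> j} \<subseteq> insert p {j \<in> J. t \<le> j}"
          using q by (fastforce simp: X_def)
        from card_mono[OF _ this] have "card {j \<in> J. Suc q \<le> j} \<le> Suc (card {j \<in> J. t \<le> j})"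
          using card_insert_le_m1[of "Suc (card {j \<in> J. t \<le> j})" "{j \<in> J. t \<le> j}" p] by simp
        then have many: "Suc d \<le> card {x \<in> C. x < Suc q}"
          using wide[of "Suc q"] few J_t by auto
        obtain x where x: "x \<in> C" "q < x" "x \<le> p"
          using gap[of a q p] a(1) p(1) q(1) \<open>q < p\<close> by (auto simp: X_def)
        have "b \<le> q"
          using q(1) b_le by (simp add: X_def)
        have "x < t"
          using x(3) p(1) by (simp add: X_def)
        \<comment> \<open>From the \<open>Suc d\<close> columns up to \<open>q\<close> two are
          removed and \<open>x\<close> is gained, which leaves \<open>d\<close>.\<close>
        have "insert x ({x \<in> C. x < Suc q} - {c} - {a}) \<subseteq> {x \<in> ?C. x < t}"
          using x \<open>x < t\<close> \<open>b \<le> q\<close> b c by auto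
        from card_mono[OF _ this]
        have "Suc (card ({x \<in> C. x < Suc q} - {c} - {a})) \<le> card {x \<in> ?C. x < t}"
          using x by simp
        moreover have "c \<in> {x \<in> C. x < Suc q}" "a \<in> {x \<in> C. x < Suc q} - {c}"
          using a(1) b c \<open>b \<le> q\<close> by auto
        ultimately show "d \<le> card {x \<in> ?C. x < t}"
          using many by (simp add: card_Diff_singleton)
      qed
    qed simp_all
  qed
  show ?case
  proof (rule squares.acyclic_below_independent_vertices[where V = V])
    have "V \<subseteq> C \<times> J"
      using a by (auto simp: V_def)
    then show "finite V"
      by (rule finite_subset) simp
    show "\<tau> \<in> ?K" if "\<sigma> \<in> ?K" "\<tau> \<subseteq> \<sigma>" for \<sigma> \<tau>
      using that by (rule rook_placements_downward)
    show "u = v" if "\<sigma> \<in> ?K" "u \<in> V \<inter> \<sigma>" "v \<in> V \<inter> \<sigma>" for \<sigma> u v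
      using that rook_placements_columnD[of \<sigma> C J] unfolding V_def by auto
    show "squares.acyclic_below {\<sigma> \<in> ?K. V \<inter> \<sigma> = {}} (Suc d)"
      using \<open>squares.acyclic_below K' (Suc d)\<close> by (simp add: K'_def)
    fix v assume "v \<in> V"
    then obtain j where v: "v = (a, j)" and j: "j \<in> J" "a \<le> j" "j \<noteq> b"
      by (auto simp: V_def)
    let ?C = "C - {a}" and ?J = "J - {j}"
    have link: "{\<sigma>. v \<notin> \<sigma> \<and> insert v \<sigma> \<in> ?K} = rook_placements ?C ?J"
      using rook_placements_insert_iff[of a j _ C J] a(1) j by (auto simp: v)
    show "squares.acyclic_below {\<sigma>. v \<notin> \<sigma> \<and> insert v \<sigma> \<in> ?K} d"
      unfolding link
    proof (rule Suc.IH)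
      fix i k k' assume *: "i \<in> ?C" "i \<le> k" "k \<in> ?J" "k' \<in> ?J" "k < k'"
      then obtain x where x: "x \<in> C" "k < x" "x \<le> k'"
        using gap[of i k k'] by auto
      with a(2)[of i] * have "x \<in> ?C"
        by auto
      with x show "\<exists>x\<in>?C. k < x \<and> x \<le> k'"
        by blast
    next
      fix t
      \<comment> \<open>Here one column and one row go, so either count falls by at most
        one.\<close>
      have *: "{x \<in> ?C. x < t} = {x \<in> C. x < t} - {a}" "{i \<in> ?J. t \<le> i} = {i \<in> J. t \<le> i} - {j}"
        by auto
      have "d \<le> card (A - {x})" if "Suc d \<le> card A" for A :: "nat set" and x
        using diff_card_le_card_Diff[of "{x}" A] that by simp
      then show "d \<le> card {x \<in> ?C. x < t} \<or> d \<le> card {i \<in> ?J. t \<le> i}"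
        unfolding * using wide[of t] by blast
    qed simp_all
  qed
qed

section \<open>The facets and the complex that remains without them\<close>

text \<open>Having as many rooks as columns means that every column is occupied, for finite
  \<open>C\<close>.\<close>

definition perfect_placements :: "nat set \<Rightarrow> nat set \<Rightarrow> (nat \<times> nat) set set" where
  "perfect_placements C J = {\<sigma> \<in> rook_placements C J. card \<sigma> = card C}"

lemma rook_placements_finite:
  assumes "finite C" "finite J" "\<sigma> \<in> rook_placements C J"
  shows "finite \<sigma>"
proof (rule finite_subset)
  show "\<sigma> \<subseteq> C \<times> J"
    using rook_placements_squareD[OF assms(3)] by auto
qed (use assms in simp)

lemma rook_placements_mono:
  "C \<subseteq> C' \<Longrightarrow> J \<subseteq> J' \<Longrightarrow> rook_placements C J \<subseteq> rook_placements C' J'"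
  unfolding rook_placements_def by fastforce

lemma perfect_placements_insert_iff:
  assumes "finite C" "finite J"
  shows "insert (i, j) \<sigma> \<in> perfect_placements C J \<and> (i, j) \<notin> \<sigma> \<longleftrightarrow>
     i \<in> C \<and> j \<in> J \<and> i \<le> j \<and> \<sigma> \<in> perfect_placements (C - {i}) (J - {j})"
  (is "?L \<longleftrightarrow> ?R")
proof -
  have "card C > 0" if "i \<in> C"
    using that assms card_gt_0_iff by blast
  moreover have "finite \<sigma>" if "\<sigma> \<in> rook_placements (C - {i}) (J - {j})"
    using that assms by (intro rook_placements_finite[of "C - {i}" "J - {j}"]) auto
  ultimately show ?thesis
    using rook_placements_insert_iff[of i j \<sigma> C J] assms
    by (auto simp: perfect_placements_def card_Diff_singleton)
qed

lemma perfect_placements_cover: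
  assumes "finite C" "finite J" "card C = card J" "\<sigma> \<in> perfect_placements C J"
  shows "fst ` \<sigma> = C" "snd ` \<sigma> = J"
proof -
  have \<sigma>: "\<sigma> \<in> rook_placements C J" "card \<sigma> = card C"
    using assms by (simp_all add: perfect_placements_def)
  have "fst ` \<sigma> \<subseteq> C" "snd ` \<sigma> \<subseteq> J"
    using rook_placements_squareD[OF \<sigma>(1)] by auto
  moreover have "inj_on fst \<sigma>" "inj_on snd \<sigma>"
    using rook_placements_columnD[OF \<sigma>(1)] rook_placements_rowD[OF \<sigma>(1)]
    by (auto simp: inj_on_def)
  ultimately show "fst ` \<sigma> = C" "snd ` \<sigma> = J"
    using assms \<sigma> by (simp_all add: card_subset_eq card_image)
qed

text \<open>Columns up to \<open>n\<close> and all rows of \<open>J\<close> are taken, so a further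
  rook would stand in a column above \<open>n\<close> and a row at most \<open>n\<close>, against
  \<open>i \<le> j\<close>.\<close>

lemma perfect_placement_maximal:
  assumes "finite J" "\<And>j. j \<in> J \<Longrightarrow> n < j" "card J = n - s"
    and "\<tau> \<in> perfect_placements {s<..n} J" "\<sigma> \<in> rook_placements {s<..m} ({s<..n} \<union> J)" "\<tau> \<subseteq> \<sigma>"
  shows "\<sigma> = \<tau>"
proof (rule ccontr)
  assume "\<sigma> \<noteq> \<tau>"
  then obtain i j where ij: "(i, j) \<in> \<sigma>" "(i, j) \<notin> \<tau>"
    using assms(6) by auto
  have cover: "fst ` \<tau> = {s<..n}" "snd ` \<tau> = J"
    using perfect_placements_cover[OF _ _ _ assms(4)] assms by auto
  have "i \<notin> {s<..n}"
  proof
    assume "i \<in> {s<..n}"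
    then obtain j' where "(i, j') \<in> \<tau>"
      using cover by force
    then show False
      using rook_placements_columnD[OF assms(5), of i j j'] ij assms(6) by auto
  qed
  moreover have "j \<notin> J"
  proof
    assume "j \<in> J"
    then obtain i' where "(i', j) \<in> \<tau>"
      using cover by force
    then show False
      using rook_placements_rowD[OF assms(5), of i j i'] ij assms(6) by auto
  qed
  ultimately show False
    using rook_placements_squareD[OF assms(5) ij(1)] by auto
qed

text \<open>Induction along the first column \<open>a = s + 1\<close>. Keeping only
  \<open>(a, a)\<close> in it gives a cone. The link of a rook in a row of \<open>J\<close> is the
  same situation with \<open>s + 1\<close>; a rook in a lower row lies in no perfect placement, and
  its link is covered by the result on general boards.\<close>

lemma acyclic_below_imperfect_placements:
  assumes "J \<subseteq> {s + k<..2 * (s + k)}" "card J = k"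
  shows "squares.acyclic_below
      (rook_placements {s<..2 * (s + k)} ({s<..s + k} \<union> J) - perfect_placements {s<..s + k} J) (Suc k)"
  using assms
proof (induction k arbitrary: s J)
  case 0
  have "finite J"
    using 0 finite_subset by blast
  then have "J = {}"
    using 0 by simp
  have "\<sigma> = {}" if "\<sigma> \<in> rook_placements C {}" for \<sigma> C
    using that rook_placements_squareD[of \<sigma> C "{}"] by auto
  moreover have "{} \<in> perfect_placements {s<..s + 0} {}"
    by (simp add: perfect_placements_def rook_placements_def)
  ultimately have "rook_placements {s<..2 * (s + 0)} {} \<subseteq> perfect_placements {s<..s + 0} {}"
    by (metis subsetI)
  \<comment> \<open>The only placement is the empty one, and it is perfect, so the difference has no
    faces at all, not even the empty one.\<close>
  then have "rook_placements {s<..2 * (s + 0)} ({s<..s + 0} \<union> J) - perfect_placements {s<..s + 0} J = {}"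
    using \<open>J = {}\<close> by simp
  moreover have "squares.acyclic_below {} (Suc 0)"
    by (rule squares.acyclic_below_cone) simp
  ultimately show ?case
    by (simp only:)
next
  case (Suc k)
  define n where "n = s + Suc k"
  define a where "a = Suc s"
  have n_eq: "s + Suc k = n" "a + k = n"
    by (simp_all add: n_def a_def)
  have J: "J \<subseteq> {n<..2 * n}" "card J = Suc k"
    using Suc.prems by (simp_all add: n_def)
  then have finJ [simp]: "finite J"
    using finite_subset by blast
  let ?C = "{s<..2 * n}" and ?J = "{s<..n} \<union> J"
  let ?F = "perfect_placements {s<..n} J"
  let ?K = "rook_placements ?C ?J - ?F"
  define V where "V = {(a, j) | j. j \<in> ?J \<and> j \<noteq> a}"
  have low_square: "\<sigma> \<notin> ?F" if "(i, j) \<in> \<sigma>" "j \<le> n" for i j \<sigma>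
    using that J rook_placements_squareD[of \<sigma> "{s<..n}" J i j] by (auto simp: perfect_placements_def)
  have "squares.acyclic_below ?K (Suc (Suc k))"
  proof (rule squares.acyclic_below_independent_vertices[where V = V])
    have "V = Pair a ` (?J - {a})"
      by (auto simp: V_def)
    then show "finite V"
      by simp
    show "\<tau> \<in> ?K" if "\<sigma> \<in> ?K" "\<tau> \<subseteq> \<sigma>" for \<sigma> \<tau>
    proof -
      have "n < j" if "j \<in> J" for j
        using that J(1) by auto
      moreover have "card J = n - s"
        using J(2) by (simp add: n_def)
      ultimately have "\<tau> \<notin> ?F"
        using perfect_placement_maximal[OF finJ, of n s \<tau> \<sigma> "2 * n"] that by blast
      then show ?thesis
        using that rook_placements_downward[of \<sigma> ?C ?J \<tau>] by blast
    qed
    show "u = v" if "\<sigma> \<in> ?K" "u \<in> V \<inter> \<sigma>" "v \<in> V \<inter> \<sigma>" for \<sigma> u v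
      using that rook_placements_columnD[of \<sigma> ?C ?J] unfolding V_def by auto
    show "squares.acyclic_below {\<sigma> \<in> ?K. V \<inter> \<sigma> = {}} (Suc (Suc k))"
    proof (rule squares.acyclic_below_cone[where v = "(a, a)"])
      fix \<sigma> assume \<sigma>: "\<sigma> \<in> {\<sigma> \<in> ?K. V \<inter> \<sigma> = {}}"
      then have \<sigma>': "\<sigma> \<in> rook_placements ?C ?J"
        by simp
      have "j = a" if "(a, j) \<in> \<sigma>" for j
        using that \<sigma> rook_placements_squareD[OF \<sigma>' that] by (auto simp: V_def)
      \<comment> \<open>Row \<open>a\<close> has the single square \<open>(a, a)\<close>, as all
        columns are at least \<open>a\<close>.\<close>
      moreover have "c = a" if "(c, a) \<in> \<sigma>" for c
        using rook_placements_squareD[OF \<sigma>' that] by (auto simp: a_def)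
      ultimately have "insert (a, a) \<sigma> \<in> rook_placements ?C ?J"
        using \<sigma>' by (intro rook_placements_insertI) (auto simp: a_def n_def)
      moreover have "insert (a, a) \<sigma> \<notin> ?F"
        by (rule low_square[of a a]) (auto simp: a_def n_def)
      ultimately show "insert (a, a) \<sigma> \<in> {\<sigma> \<in> ?K. V \<inter> \<sigma> = {}}"
        using \<sigma> by (auto simp: V_def)
    qed
    fix v assume "v \<in> V"
    then obtain j where v: "v = (a, j)" and j: "j \<in> ?J" "j \<noteq> a"
      by (auto simp: V_def)
    have aj: "a \<in> ?C" "a \<in> {s<..n}" "a \<le> j"
      using j J by (auto simp: a_def n_def)
    have link: "{\<sigma>. v \<notin> \<sigma> \<and> insert v \<sigma> \<in> ?K} =
        rook_placements (?C - {a}) (?J - {j}) - {\<sigma>. v \<notin> \<sigma> \<and> insert v \<sigma> \<in> ?F}"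
      using rook_placements_insert_iff[of a j _ ?C ?J] aj j by (auto simp: v)
    show "squares.acyclic_below {\<sigma>. v \<notin> \<sigma> \<and> insert v \<sigma> \<in> ?K} (Suc k)"
    proof (cases "j \<in> J")
      case True
      have C_eq: "?C - {a} = {a<..2 * n}" "{s<..n} - {a} = {a<..n}"
        by (auto simp: a_def)
      \<comment> \<open>Row \<open>a\<close> is still listed on the left, but no remaining column
        reaches it.\<close>
      have "rook_placements (?C - {a}) (?J - {j}) = rook_placements {a<..2 * n} ({a<..n} \<union> (J - {j}))"
        unfolding C_eq using True J by (intro rook_placements_cong) (auto simp: a_def)
      moreover have "{\<sigma>. v \<notin> \<sigma> \<and> insert v \<sigma> \<in> ?F} = perfect_placements {a<..n} (J - {j})"
        using perfect_placements_insert_iff[of "{s<..n}" J a j] aj True C_eq(2) by (auto simp: v)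
      ultimately show ?thesis
        unfolding link using Suc.IH[of "J - {j}" a] J True
        by (auto simp: n_eq card_Diff_singleton)
    next
      case False
      then have "j \<le> n"
        using j by simp
      then have "{\<sigma>. v \<notin> \<sigma> \<and> insert v \<sigma> \<in> ?F} = {}"
        using low_square[of a j] by (auto simp: v)
      then have "{\<sigma>. v \<notin> \<sigma> \<and> insert v \<sigma> \<in> ?K} = rook_placements (?C - {a}) (?J - {j})"
        using link by (simp only: Diff_empty)
      moreover have "squares.acyclic_below (rook_placements (?C - {a}) (?J - {j})) (Suc k)"
      proof (rule acyclic_below_rook_placements)
        fix t
        \<comment> \<open>Up to \<open>t = n + 1\<close> all \<open>k + 1\<close> rows of
          \<open>J\<close> count; beyond that the columns \<open>a + 1, ..., n + 1\<close>
          do.\<close>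
        show "Suc k \<le> card {c \<in> ?C - {a}. c < t} \<or> Suc k \<le> card {i \<in> ?J - {j}. t \<le> i}"
        proof (cases "t \<le> Suc n")
          case True
          then have "J \<subseteq> {i \<in> ?J - {j}. t \<le> i}"
            using J False by fastforce
          from card_mono[OF _ this] show ?thesis
            using J by simp
        next
          case False
          then have "{Suc a..Suc n} \<subseteq> {c \<in> ?C - {a}. c < t}"
            by (auto simp: a_def n_def)
          from card_mono[OF _ this] show ?thesis
            by (simp add: a_def n_def)
        qed
      next
        fix i x y
        assume "i \<in> ?C - {a}" "i \<le> x" "x \<in> ?J - {j}" "y \<in> ?J - {j}" "x < y"
        \<comment> \<open>Every row above \<open>a\<close> is also the label of a column, so
          \<open>y\<close> itself fills the gap.\<close>
        then have "y \<in> ?C - {a}"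
          using J by (auto simp: a_def)
        then show "\<exists>c\<in>?C - {a}. x < c \<and> c \<le> y"
          using \<open>x < y\<close> by blast
      qed simp_all
      ultimately show ?thesis by simp
    qed
  qed
  then show ?case
    by (simp add: n_def)
qed

section \<open>Counting the facets\<close>

text \<open>All rows exceed all columns here, so \<open>i \<le> j\<close> holds automatically and
  the placements are the graphs of permutations, shifted by \<open>n\<close>.\<close>

lemma card_perfect_placements:
  "card (perfect_placements {0<..n} {n<..2 * n}) = fact n"
proof -
  define g where "g p = (\<lambda>i. (i, n + p i)) ` {0<..n}" for p :: "nat \<Rightarrow> nat"
  have "bij_betw g {p. p permutes {0<..n}} (perfect_placements {0<..n} {n<..2 * n})"
  proof (rule bij_betw_imageI)
    show "inj_on g {p. p permutes {0<..n}}"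
    proof (rule inj_onI)
      fix p q assume pq: "p \<in> {p. p permutes {0<..n}}" "q \<in> {p. p permutes {0<..n}}" "g p = g q"
      show "p = q"
      proof (rule ext)
        fix i
        show "p i = q i"
        proof (cases "i \<in> {0<..n}")
          case True
          then have "(i, n + p i) \<in> g q"
            unfolding pq(3)[symmetric] unfolding g_def by (rule imageI)
          then show ?thesis
            by (auto simp: g_def)
        next
          case False
          then show ?thesis
            using pq permutes_not_in[of p _ i] permutes_not_in[of q _ i] by (metis mem_Collect_eq)
        qed
      qed
    qed
    show "g ` {p. p permutes {0<..n}} = perfect_placements {0<..n} {n<..2 * n}"
    proof (intro equalityI subsetI)
      fix \<sigma> assume "\<sigma> \<in> g ` {p. p permutes {0<..n}}"
      then obtain p where p: "p permutes {0<..n}" and \<sigma>: "\<sigma> = g p"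
        by blast
      have "p i \<in> {0<..n}" if "i \<in> {0<..n}" for i
        using that permutes_in_image[OF p] by blast
      then have "\<sigma> \<in> rook_placements {0<..n} {n<..2 * n}"
        using injD[OF permutes_inj[OF p]]
        by (intro rook_placementsI) (fastforce simp: \<sigma> g_def)+
      moreover have "card \<sigma> = n"
        unfolding \<sigma> g_def by (subst card_image) (auto intro: inj_onI)
      ultimately show "\<sigma> \<in> perfect_placements {0<..n} {n<..2 * n}"
        by (simp add: perfect_placements_def)
    next
      fix \<sigma> assume \<sigma>: "\<sigma> \<in> perfect_placements {0<..n} {n<..2 * n}"
      then have rook: "\<sigma> \<in> rook_placements {0<..n} {n<..2 * n}"
        by (simp add: perfect_placements_def)
      have cover: "fst ` \<sigma> = {0<..n}"
        using perfect_placements_cover(1)[OF _ _ _ \<sigma>] by simp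
      then have "\<forall>i\<in>{0<..n}. \<exists>j. (i, j) \<in> \<sigma>"
        by force
      then obtain f where f: "(i, f i) \<in> \<sigma>" if "i \<in> {0<..n}" for i
        by metis
      have f_range: "f i \<in> {n<..2 * n}" if "i \<in> {0<..n}" for i
        using rook_placements_squareD[OF rook f[OF that]] by simp
      \<comment> \<open>The value \<open>i\<close> outside the columns is what
        \<open>permutes\<close> demands.\<close>
      define p where "p i = (if i \<in> {0<..n} then f i - n else i)" for i
      have inj: "inj_on p {0<..n}"
      proof (rule inj_onI)
        fix i i' assume *: "i \<in> {0<..n}" "i' \<in> {0<..n}" "p i = p i'"
        then have "f i - n = f i' - n"
          by (simp add: p_def)
        then have "f i = f i'"
          using f_range[OF *(1)] f_range[OF *(2)] unfolding greaterThanAtMost_iff by linarith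
        then show "i = i'"
          using rook_placements_rowD[OF rook f[OF *(1)], of i'] f[OF *(2)] by simp
      qed
      have "p ` {0<..n} \<subseteq> {0<..n}"
        using f_range by (fastforce simp: p_def)
      then have "p ` {0<..n} = {0<..n}"
        using inj by (intro endo_inj_surj) auto
      then have "p permutes {0<..n}"
        using inj by (intro bij_imp_permutes bij_betw_imageI) (auto simp: p_def)
      moreover have "\<sigma> = g p"
      proof (intro equalityI subsetI)
        fix s assume s: "s \<in> \<sigma>"
        obtain i j where ij: "s = (i, j)" by (cases s)
        have i: "i \<in> {0<..n}"
          using rook_placements_squareD[OF rook] s ij by blast
        have "j = f i"
          using rook_placements_columnD[OF rook _ f[OF i]] s ij by blast
        then show "s \<in> g p"
          using i f_range[OF i] by (auto simp: g_def p_def ij)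
      next
        fix s assume "s \<in> g p"
        then obtain i where i: "i \<in> {0<..n}" "s = (i, n + p i)"
          by (auto simp: g_def)
        then show "s \<in> \<sigma>"
          using f[OF i(1)] f_range[OF i(1)] by (simp add: p_def)
      qed
      ultimately show "\<sigma> \<in> g ` {p. p permutes {0<..n}}"
        by blast
    qed
  qed
  then have "card (perfect_placements {0<..n} {n<..2 * n}) = card {p. p permutes {0<..n}}"
    using bij_betw_same_card by metis
  also have "\<dots> = fact n"
    by (rule card_permutations) simp_all
  finally show ?thesis .
qed

theorem corollary5p7:
  fixes n :: nat
  assumes "n \<ge> 1"
  shows "reduced_betti square_order (stirling_complex (2 * n)) (int n - 1) = enat (fact n)"
proof -
  let ?F = "perfect_placements {0<..n} {n<..2 * n}"
  have board: "{0<..2 * n} = {0<..n} \<union> {n<..2 * n}"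
    by auto
  have "{1..2 * n} = {0<..2 * n}"
    by auto
  then have K: "stirling_complex (2 * n) = rook_placements {0<..2 * n} ({0<..n} \<union> {n<..2 * n})"
    by (simp only: stirling_complex_eq flip: board)
  \<comment> \<open>The cardinality \<open>fact n\<close> is nonzero, whereas an infinite set would
    have \<open>card\<close> 0.\<close>
  have finite_F: "finite ?F"
    using card_perfect_placements[of n] by (metis card.infinite fact_nonzero)
  have "reduced_betti square_order (stirling_complex (2 * n)) (int (n - 1)) = enat (card ?F)"
    unfolding K
  proof (rule squares.reduced_betti_eq_card_facets[OF _ finite_F])
    show "?F \<subseteq> rook_placements {0<..2 * n} ({0<..n} \<union> {n<..2 * n})"
    proof
      fix \<sigma> assume "\<sigma> \<in> ?F"
      then have "\<sigma> \<in> rook_placements {0<..n} {n<..2 * n}"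
        by (simp add: perfect_placements_def)
      moreover have "{0<..n} \<subseteq> {0<..2 * n}"
        by auto
      ultimately show "\<sigma> \<in> rook_placements {0<..2 * n} ({0<..n} \<union> {n<..2 * n})"
        using rook_placements_mono by blast
    qed
    show "card \<sigma> = Suc (n - 1)" if "\<sigma> \<in> ?F" for \<sigma>
      using that assms by (simp add: perfect_placements_def)
    show "\<tau> = \<sigma>" if "\<sigma> \<in> ?F" "\<tau> \<in> rook_placements {0<..2 * n} ({0<..n} \<union> {n<..2 * n})" "\<sigma> \<subseteq> \<tau>"
      for \<sigma> \<tau>
      using perfect_placement_maximal[OF _ _ _ that(1,2,3)] by simp
    \<comment> \<open>The instance \<open>s = 0\<close>, \<open>k = n\<close>, with all upper rows
      in \<open>J\<close>.\<close>
    show "squares.acyclic_below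
        (rook_placements {0<..2 * n} ({0<..n} \<union> {n<..2 * n}) - ?F) (Suc (Suc (n - 1)))"
      using acyclic_below_imperfect_placements[of "{n<..2 * n}" 0 n] assms by simp
  qed (rule rook_placements_downward)
  then show ?thesis
    using assms by (simp add: card_perfect_placements of_nat_diff)
qed

end
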